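(* Let $D$ be any complex number and put $A=D-2$, $B=-3D+6$, $C=-D+3$. Then for every integer $n\ge 0$, $$\begin{aligned} &\sum_{\substack{k_1+k_2+k_3=n\\ k_1,k_2,k_3\ge 0}}\binom{n}{k_1,k_2,k_3}T_{k_1}T_{k_2}T_{k_3}\\ &=\frac{A}{563}3^nT_n^{(15,27,48,107)}-\frac{B}{563}\sum_{k=0}^n\binom nk(-1)^kT_k^{(-5,2,13,32)}\\ &\quad+\frac{C}{563}\sum_{k=0}^n\binom nk2^{n-k}T_{n-k}^{(40,64,215,344)}T_k+D\sum_{k=0}^n\binom nkT_kt_{n-k}, \end{aligned}$$ where $$t_n=\frac12\left(\sum_{k=0}^n\binom nkT_kT_{n-k}-\frac{2^n}{563}T_n^{(40,64,215,344)}\right).$$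
   Context: For given $s_0,s_1,s_2,s_3$, the sequence $T_n^{(s_0,s_1,s_2,s_3)}$ is defined by $T_j^{(s_0,s_1,s_2,s_3)}=s_j$ for $0\le j\le 3$ and, for $n\ge4$, each term being the sum of the four preceding terms. The Tetranacci numbers are $T_n=T_n^{(0,1,1,2)}$. The multinomial coefficient is $\binom{n}{k_1,\dots,k_r}=\frac{n!}{k_1!\cdots k_r!}$. *)

theory Defs
  imports Complex_Main
begin

text \<open>The Tetranacci-type sequences are taken with complex values, because they are combined
  with rational coefficients and an arbitrary complex parameter.\<close>

fun gen_tetranacci :: "complex \<Rightarrow> complex \<Rightarrow> complex \<Rightarrow> complex \<Rightarrow> nat \<Rightarrow> complex" where
  "gen_tetranacci s0 s1 s2 s3 0 = s0"
| "gen_tetranacci s0 s1 s2 s3 (Suc 0) = s1"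
| "gen_tetranacci s0 s1 s2 s3 (Suc (Suc 0)) = s2"
| "gen_tetranacci s0 s1 s2 s3 (Suc (Suc (Suc 0))) = s3"
| "gen_tetranacci s0 s1 s2 s3 (Suc (Suc (Suc (Suc n)))) =
     gen_tetranacci s0 s1 s2 s3 (Suc (Suc (Suc n))) + gen_tetranacci s0 s1 s2 s3 (Suc (Suc n))
     + gen_tetranacci s0 s1 s2 s3 (Suc n) + gen_tetranacci s0 s1 s2 s3 n"

definition tetranacci :: "nat \<Rightarrow> complex" where
  "tetranacci = gen_tetranacci 0 1 1 2"

definition multinomial :: "nat \<Rightarrow> nat list \<Rightarrow> complex" where
  "multinomial n ks = fact n / (\<Prod>k\<leftarrow>ks. fact k)"

definition tetranacci_t :: "nat \<Rightarrow> complex" where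
  "tetranacci_t n =
     1 / 2 * ((\<Sum>k=0..n. of_nat (n choose k) * tetranacci k * tetranacci (n - k))
              - 2 ^ n / 563 * gen_tetranacci 40 64 215 344 n)"

end

theory Submission
  imports
    Defs
    "HOL-Computational_Algebra.Formal_Power_Series"
    "HOL-Computational_Algebra.Fundamental_Theorem_Algebra"
begin

text \<open>
  Binomial and multinomial convolutions of sequences are products of their exponential generating
  functions. Let \<open>a, b, c, d\<close> be the roots of \<open>x^4 - x^3 - x^2 - x - 1\<close>. The Tetranacci numbers
  have a Binet formula, so that their generating function is a sum of four terms
  \<open>X = q(a) exp(a z)\<close>, \<open>Y = q(b) exp(b z)\<close>, \<open>Z = q(c) exp(c z)\<close>, \<open>W = q(d) exp(d z)\<close>, where \<open>q\<close> is an explicit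
  cubic polynomial. Write \<open>p1, p2, p3\<close> for the power sums and \<open>e2, e3\<close> for the elementary
  symmetric polynomials of \<open>X, Y, Z, W\<close>. The left-hand side has generating function \<open>p1^3\<close>, and
  every sequence on the right-hand side is one of these symmetric polynomials in disguise:

  \<^item> \<open>2^n\<close> and \<open>3^n\<close> times the sequences starting with 40 and 15 give \<open>563 p2\<close> and \<open>563 p3\<close>, since
    a power of \<open>q(x) exp(x z)\<close> is \<open>q(x)^k exp(k x z)\<close> (lemmas \<open>egf_scaled_squares\<close> and
    \<open>egf_scaled_cubes\<close>).
  \<^item> The alternating binomial sum gives \<open>- 563 e3\<close> (lemma \<open>egf_alternating_triples\<close>). As the roots
    add up to 1, a product of three terms has exponent \<open>1 - x\<close> with \<open>x\<close> the missing root; its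
    coefficient is the product of all four values of \<open>q\<close>, namely \<open>- 1 / 563\<close>, divided by \<open>q(x)\<close>.
    The number \<open>- 563\<close> is the discriminant of the characteristic polynomial.
  \<^item> \<open>tetranacci_t\<close> gives \<open>(p1^2 - p2) / 2 = e2\<close>.

  What remains is an identity of symmetric polynomials: for \<open>D = 0\<close> it is
  \<open>p1^3 = 3 p1 p2 - 2 p3 + 6 e3\<close>, and \<open>D\<close> multiplies the expression \<open>p3 - p1 p2 + p1 e2 - 3 e3\<close>, which vanishes by
  Newton's identity.
\<close>

section \<open>Exponential generating functions\<close>

unbundle fps_syntax

definition egf :: "(nat \<Rightarrow> complex) \<Rightarrow> complex fps" where
  "egf f = Abs_fps (\<lambda>n. f n / fact n)"

lemma egf_nth [simp]: "egf f $ n = f n / fact n"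
  by (simp add: egf_def)

lemma egf_inject: "egf f = egf g \<longleftrightarrow> f = g"
  by (auto simp: fps_eq_iff fun_eq_iff)

lemma egf_add: "egf (\<lambda>n. f n + g n) = egf f + egf g"
  by (simp add: fps_eq_iff add_divide_distrib)

lemma egf_diff: "egf (\<lambda>n. f n - g n) = egf f - egf g"
  by (simp add: fps_eq_iff diff_divide_distrib)

lemma egf_cmult: "egf (\<lambda>n. z * f n) = fps_const z * egf f"
  by (simp add: fps_eq_iff)

lemma egf_power: "egf (\<lambda>n. x ^ n) = fps_exp x"
  by (simp add: fps_eq_iff)

lemma egf_binomial_convolution:
  "egf (\<lambda>n. \<Sum>k=0..n. of_nat (n choose k) * f k * g (n - k)) = egf f * egf g"
proof (rule fps_ext)
  fix n
  have "(\<Sum>k=0..n. of_nat (n choose k) * f k * g (n - k)) / fact n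
        = (\<Sum>k=0..n. f k / fact k * (g (n - k) / fact (n - k)))"
    by (auto simp: sum_divide_distrib binomial_fact field_simps intro!: sum.cong)
  then show "egf (\<lambda>n. \<Sum>k=0..n. of_nat (n choose k) * f k * g (n - k)) $ n = (egf f * egf g) $ n"
    by (simp add: fps_mult_nth)
qed

lemma egf_multinomial_convolution:
  "egf (\<lambda>n. \<Sum>(k1, k2, k3) \<in> {(k1, k2, k3). k1 + k2 + k3 = n}.
          multinomial n [k1, k2, k3] * f k1 * g k2 * h k3) = egf f * egf g * egf h"
proof (rule fps_ext)
  fix n
  have "(\<Sum>(k1, k2, k3) \<in> {(k1, k2, k3). k1 + k2 + k3 = n}.
          multinomial n [k1, k2, k3] * f k1 * g k2 * h k3) / fact n
        = (\<Sum>(k1, k2, k3) \<in> {(k1, k2, k3). k1 + k2 + k3 = n}.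
             f k1 / fact k1 * (g k2 / fact k2) * (h k3 / fact k3))"
    by (auto simp: sum_divide_distrib multinomial_def mult_ac intro!: sum.cong)
  \<comment> \<open>the index set of an iterated Cauchy product, with \<open>m = k1 + k2\<close> and \<open>k = k1\<close>\<close>
  also have "\<dots> = (\<Sum>(m, k) \<in> (SIGMA m:{0..n}. {0..m}).
             f k / fact k * (g (m - k) / fact (m - k)) * (h (n - m) / fact (n - m)))"
    by (rule sum.reindex_bij_witness[where
          i = "\<lambda>(m, k). (k, m - k, n - m)" and j = "\<lambda>(k1, k2, k3). (k1 + k2, k1)"]) auto
  also have "\<dots> = (egf f * egf g * egf h) $ n"
    by (subst sum.Sigma[symmetric]) (simp_all add: fps_mult_nth sum_distrib_right sum_divide_distrib)
  finally show "egf (\<lambda>n. \<Sum>(k1, k2, k3) \<in> {(k1, k2, k3). k1 + k2 + k3 = n}.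
          multinomial n [k1, k2, k3] * f k1 * g k2 * h k3) $ n = (egf f * egf g * egf h) $ n"
    by simp
qed

section \<open>The characteristic roots\<close>

text \<open>
  The assumptions are Vieta's relations rather than the equation that each root satisfies: they also
  determine the power sums of the roots and the product of the Binet coefficients.
\<close>

locale tetranacci_roots =
  fixes a b c d :: complex
  assumes e1: "a + b + c + d = 1"
    and e2: "a * b + a * c + a * d + b * c + b * d + c * d = - 1"
    and e3: "a * b * c + a * b * d + a * c * d + b * c * d = 1"
    and e4: "a * b * c * d = - 1"
begin

definition root_sum :: "(complex \<Rightarrow> 'b) \<Rightarrow> 'b :: ab_group_add" where
  "root_sum f = f a + f b + f c + f d"

lemma charpoly_factorization:
  "x ^ 4 - x ^ 3 - x ^ 2 - x - 1 = (x - a) * (x - b) * (x - c) * (x - d)"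
proof -
  have "(x - a) * (x - b) * (x - c) * (x - d) =
        x ^ 4 - (a + b + c + d) * x ^ 3
        + (a * b + a * c + a * d + b * c + b * d + c * d) * x ^ 2
        - (a * b * c + a * b * d + a * c * d + b * c * d) * x + a * b * c * d"
    by algebra
  then show ?thesis
    unfolding e1 e2 e3 e4 by simp
qed

lemma charpoly_root:
  assumes "x \<in> {a, b, c, d}"
  shows "x ^ 4 = x ^ 3 + x ^ 2 + x + 1"
proof -
  have "x ^ 4 - x ^ 3 - x ^ 2 - x - 1 = 0"
    using assms unfolding charpoly_factorization by auto
  then show ?thesis
    by (simp add: algebra_simps)
qed

text \<open>
  The derivative of the factored characteristic polynomial, by the product rule. At a root only
  one of the four summands survives: the product of the differences to the other roots.
\<close>

lemma charpoly_deriv: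
  "4 * x ^ 3 - 3 * x ^ 2 - 2 * x - 1 =
     (x - b) * (x - c) * (x - d) + (x - a) * (x - c) * (x - d)
     + (x - a) * (x - b) * (x - d) + (x - a) * (x - b) * (x - c)"
proof -
  have "(x - b) * (x - c) * (x - d) + (x - a) * (x - c) * (x - d)
        + (x - a) * (x - b) * (x - d) + (x - a) * (x - b) * (x - c) =
        4 * x ^ 3 - 3 * (a + b + c + d) * x ^ 2
        + 2 * (a * b + a * c + a * d + b * c + b * d + c * d) * x
        - (a * b * c + a * b * d + a * c * d + b * c * d)"
    by algebra
  then show ?thesis
    unfolding e1 e2 e3 by simp
qed

text \<open>
  The product of the derivative over all roots is the product of the squared differences of the
  roots. Separating the root \<open>a\<close> from the other three turns the symmetric computation into one
  about \<open>a\<close> alone: the elementary symmetric polynomials of \<open>b, c, d\<close> are polynomials in \<open>a\<close>, and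
  the discriminant of a cubic is known in terms of them.
\<close>

lemma discriminant:
  defines "p' \<equiv> \<lambda>x. 4 * x ^ 3 - 3 * x ^ 2 - 2 * x - 1"
  shows "p' a * p' b * p' c * p' d = - 563"
proof -
  define s1 s2 s3 where "s1 = b + c + d" and "s2 = b * c + b * d + c * d" and "s3 = b * c * d"
  have s1: "s1 = 1 - a"
    using e1 unfolding s1_def by algebra
  have s2: "s2 = a ^ 2 - a - 1"
    using e2 s1 unfolding s1_def s2_def by algebra
  have s3: "s3 = 1 + a + a ^ 2 - a ^ 3"
    using e3 s2 unfolding s2_def s3_def by algebra
  have root: "a ^ 4 = a ^ 3 + a ^ 2 + a + 1"
    by (rule charpoly_root) simp
  have "p' a * p' b * p' c * p' d = (p' a) ^ 2 * ((b - c) * (b - d) * (c - d)) ^ 2"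
    unfolding p'_def charpoly_deriv by algebra
  \<comment> \<open>the discriminant of a monic cubic in terms of its coefficients\<close>
  also have "((b - c) * (b - d) * (c - d)) ^ 2 =
      s1 ^ 2 * s2 ^ 2 - 4 * s2 ^ 3 - 4 * s1 ^ 3 * s3 + 18 * s1 * s2 * s3 - 27 * s3 ^ 2"
    unfolding s1_def s2_def s3_def by algebra
  also have "(p' a) ^ 2 * \<dots> = - 563"
    using root unfolding s1 s2 s3 p'_def by algebra
  finally show ?thesis .
qed

text \<open>
  The coefficient of \<open>x ^ n\<close> in the Binet formula of the Tetranacci numbers is \<open>x^2 / p'(x)\<close>,
  where \<open>p'\<close> is the derivative of the characteristic polynomial (lemma \<open>coeff_T_deriv\<close>): this is
  partial fraction decomposition of the ordinary generating function \<open>z / (1 - z - z^2 - z^3 -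
  z^4)\<close>. Writing it as a polynomial in the root makes sums over the roots reducible to power
  sums, and products reducible modulo the characteristic polynomial.
\<close>

definition coeff_T :: "complex \<Rightarrow> complex" where
  "coeff_T x = (- 87 - 71 * x - 61 * x ^ 2 + 86 * x ^ 3) / 563"

lemma coeff_T_deriv:
  assumes "x \<in> {a, b, c, d}"
  shows "coeff_T x * (4 * x ^ 3 - 3 * x ^ 2 - 2 * x - 1) = x ^ 2"
  using charpoly_root[OF assms] unfolding coeff_T_def by algebra

lemma coeff_T_inverse:
  assumes "x \<in> {a, b, c, d}"
  shows "coeff_T x * (6 * x - x ^ 3 - 1) = 1"
  using charpoly_root[OF assms] unfolding coeff_T_def by algebra

lemma prod_coeff_T: "coeff_T a * coeff_T b * coeff_T c * coeff_T d = - 1 / 563"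
proof -
  let ?p' = "\<lambda>x. 4 * x ^ 3 - 3 * x ^ 2 - 2 * x - 1"
  have "coeff_T a * coeff_T b * coeff_T c * coeff_T d * (?p' a * ?p' b * ?p' c * ?p' d) =
        (coeff_T a * ?p' a) * (coeff_T b * ?p' b) * (coeff_T c * ?p' c) * (coeff_T d * ?p' d)"
    by (simp only: mult_ac)
  also have "\<dots> = (a * b * c * d) ^ 2"
    by (simp add: coeff_T_deriv power_mult_distrib)
  finally show ?thesis
    unfolding e4 discriminant by algebra
qed

text \<open>
  The product of three coefficients is the product of all four, divided by the missing one. The
  polynomial \<open>6 x - x^3 - 1\<close> is the inverse of \<open>coeff_T x\<close> at a root, and it is also the weight
  of the sequence starting with \<open>- 5, 2, 13, 32\<close> (lemma \<open>triple_sequence_binet\<close>).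
\<close>

lemma coeff_T_triple_products:
  "coeff_T b * coeff_T c * coeff_T d = - (6 * a - a ^ 3 - 1) / 563"
  "coeff_T a * coeff_T c * coeff_T d = - (6 * b - b ^ 3 - 1) / 563"
  "coeff_T a * coeff_T b * coeff_T d = - (6 * c - c ^ 3 - 1) / 563"
  "coeff_T a * coeff_T b * coeff_T c = - (6 * d - d ^ 3 - 1) / 563"
proof -
  have cofactor: "Q = - w / 563" if "u * w = 1" and "u * Q = - 1 / 563" for u w Q :: complex
  proof -
    have "Q = (u * w) * Q"
      by (simp add: that(1))
    also have "\<dots> = w * (u * Q)"
      by (simp only: mult_ac)
    finally show ?thesis
      by (simp add: that(2))
  qed
  show "coeff_T b * coeff_T c * coeff_T d = - (6 * a - a ^ 3 - 1) / 563"
    by (rule cofactor[OF coeff_T_inverse]) (use prod_coeff_T in \<open>simp_all add: mult_ac\<close>)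
  show "coeff_T a * coeff_T c * coeff_T d = - (6 * b - b ^ 3 - 1) / 563"
    by (rule cofactor[OF coeff_T_inverse]) (use prod_coeff_T in \<open>simp_all add: mult_ac\<close>)
  show "coeff_T a * coeff_T b * coeff_T d = - (6 * c - c ^ 3 - 1) / 563"
    by (rule cofactor[OF coeff_T_inverse]) (use prod_coeff_T in \<open>simp_all add: mult_ac\<close>)
  show "coeff_T a * coeff_T b * coeff_T c = - (6 * d - d ^ 3 - 1) / 563"
    by (rule cofactor[OF coeff_T_inverse]) (use prod_coeff_T in \<open>simp_all add: mult_ac\<close>)
qed

section \<open>Binet formulas\<close>

lemma power_sums:
  "root_sum (\<lambda>x. 1) = (4 :: complex)" "root_sum (\<lambda>x. x) = 1" "root_sum (\<lambda>x. x ^ 2) = 3"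
  "root_sum (\<lambda>x. x ^ 3) = 7" "root_sum (\<lambda>x. x ^ 4) = 15" "root_sum (\<lambda>x. x ^ 5) = 26"
  "root_sum (\<lambda>x. x ^ 6) = 51"
proof -
  show p0: "root_sum (\<lambda>x. 1) = (4 :: complex)" and p1: "root_sum (\<lambda>x. x) = 1"
    using e1 by (simp_all add: root_sum_def)
  show p2: "root_sum (\<lambda>x. x ^ 2) = 3" unfolding root_sum_def using e1 e2 by algebra
  show p3: "root_sum (\<lambda>x. x ^ 3) = 7" unfolding root_sum_def using e1 e2 e3 by algebra
  have rec: "root_sum (\<lambda>x. x ^ (n + 4)) =
      root_sum (\<lambda>x. x ^ (n + 3)) + root_sum (\<lambda>x. x ^ (n + 2))
      + root_sum (\<lambda>x. x ^ (n + 1)) + root_sum (\<lambda>x. x ^ n)" for n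
    by (simp add: root_sum_def power_add charpoly_root power2_eq_square power3_eq_cube algebra_simps)
  show p4: "root_sum (\<lambda>x. x ^ 4) = 15"
    using rec[of 0] p0 p1 p2 p3 by (simp add: power2_eq_square)
  show p5: "root_sum (\<lambda>x. x ^ 5) = 26"
    using rec[of 1] p1 p2 p3 p4 by (simp add: power2_eq_square power3_eq_cube mult.assoc)
  show "root_sum (\<lambda>x. x ^ 6) = 51"
    using rec[of 2] p2 p3 p4 p5 by (simp add: power2_eq_square power3_eq_cube mult.assoc)
qed

text \<open>
  Any weighted sum of \<open>n\<close>-th powers of the roots satisfies the recurrence, so it is determined by
  its first four values. For a cubic weight these are linear combinations of the power sums \<open>4,
  1, 3, 7, 15, 26, 51\<close>. Given the initial values, the weight is found by solving the linear
  system in the hypotheses.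
\<close>

lemma gen_tetranacci_binet:
  assumes "s0 = 4 * w0 + w1 + 3 * w2 + 7 * w3"
    and "s1 = w0 + 3 * w1 + 7 * w2 + 15 * w3"
    and "s2 = 3 * w0 + 7 * w1 + 15 * w2 + 26 * w3"
    and "s3 = 7 * w0 + 15 * w1 + 26 * w2 + 51 * w3"
  shows "gen_tetranacci s0 s1 s2 s3 n =
           root_sum (\<lambda>x. (w0 + w1 * x + w2 * x ^ 2 + w3 * x ^ 3) * x ^ n)"
proof -
  let ?w = "\<lambda>x. w0 + w1 * x + w2 * x ^ 2 + w3 * x ^ 3"
  have initial: "root_sum (\<lambda>x. ?w x * x ^ k) =
      w0 * root_sum (\<lambda>x. x ^ k) + w1 * root_sum (\<lambda>x. x ^ (k + 1))
      + w2 * root_sum (\<lambda>x. x ^ (k + 2)) + w3 * root_sum (\<lambda>x. x ^ (k + 3))" for k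
    by (simp add: root_sum_def power_add power2_eq_square power3_eq_cube algebra_simps)
  have rec: "root_sum (\<lambda>x. ?w x * x ^ Suc (Suc (Suc (Suc n)))) =
      root_sum (\<lambda>x. ?w x * x ^ Suc (Suc (Suc n))) + root_sum (\<lambda>x. ?w x * x ^ Suc (Suc n))
      + root_sum (\<lambda>x. ?w x * x ^ Suc n) + root_sum (\<lambda>x. ?w x * x ^ n)" for n
  proof -
    have "?w x * x ^ Suc (Suc (Suc (Suc n))) = ?w x * x ^ Suc (Suc (Suc n))
        + ?w x * x ^ Suc (Suc n) + ?w x * x ^ Suc n + ?w x * x ^ n" if "x \<in> {a, b, c, d}" for x
    proof -
      have "x ^ Suc (Suc (Suc (Suc n))) = x ^ 4 * x ^ n"
        by (simp add: eval_nat_numeral)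
      also have "\<dots> = (x ^ 3 + x ^ 2 + x + 1) * x ^ n"
        by (simp only: charpoly_root[OF that])
      also have "\<dots> = x ^ Suc (Suc (Suc n)) + x ^ Suc (Suc n) + x ^ Suc n + x ^ n"
        by (simp add: eval_nat_numeral algebra_simps)
      finally show ?thesis
        by (simp only: distrib_left)
    qed
    from this[of a] this[of b] this[of c] this[of d] show ?thesis
      by (simp only: root_sum_def insert_iff simp_thms) (simp only: ac_simps)
  qed
  show ?thesis
  proof (induction n rule: less_induct)
    case (less n)
    consider "n = 0" | "n = 1" | "n = 2" | "n = 3" | m where "n = Suc (Suc (Suc (Suc m)))"
      by (metis One_nat_def Suc_1 not0_implies_Suc numeral_3_eq_3)
    then show ?case
    proof cases
      case (5 m)
      then show ?thesis
        by (simp only: gen_tetranacci.simps rec less.IH lessI less_SucI)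
    qed (use initial[of 0] initial[of 1] initial[of 2] initial[of 3] assms power_sums in
          \<open>simp_all add: eval_nat_numeral\<close>)
  qed
qed

lemma tetranacci_binet: "tetranacci n = root_sum (\<lambda>x. coeff_T x * x ^ n)"
proof -
  have weight: "- 87 / 563 + (- 71 / 563) * x + (- 61 / 563) * x ^ 2 + 86 / 563 * x ^ 3 = coeff_T x" for x
    by (simp add: coeff_T_def add_divide_distrib diff_divide_distrib)
  have "tetranacci n = root_sum (\<lambda>x. (- 87 / 563 + (- 71 / 563) * x + (- 61 / 563) * x ^ 2
           + 86 / 563 * x ^ 3) * x ^ n)"
    unfolding tetranacci_def by (rule gen_tetranacci_binet) simp_all
  then show ?thesis
    by (simp only: weight)
qed

lemma square_sequence_binet:
  "gen_tetranacci 40 64 215 344 n = 563 * root_sum (\<lambda>x. coeff_T x ^ 2 * x ^ n)"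
proof -
  have sq: "6 + 9 * x + 28 * x ^ 2 + (- 11) * x ^ 3 = 563 * coeff_T x ^ 2" if "x \<in> {a, b, c, d}" for x
    using charpoly_root[OF that] unfolding coeff_T_def by algebra
  have "gen_tetranacci 40 64 215 344 n =
        root_sum (\<lambda>x. (6 + 9 * x + 28 * x ^ 2 + (- 11) * x ^ 3) * x ^ n)"
    by (rule gen_tetranacci_binet) simp_all
  then show ?thesis
    unfolding root_sum_def by (simp only: sq insert_iff simp_thms mult.assoc distrib_left)
qed

lemma cube_sequence_binet:
  "gen_tetranacci 15 27 48 107 n = 563 * root_sum (\<lambda>x. coeff_T x ^ 3 * x ^ n)"
proof -
  have cube: "512 / 563 + 1958 / 563 * x + (- 1220 / 563) * x ^ 2 + 1157 / 563 * x ^ 3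
      = 563 * coeff_T x ^ 3" if "x \<in> {a, b, c, d}" for x
    using charpoly_root[OF that] unfolding coeff_T_def by algebra
  have "gen_tetranacci 15 27 48 107 n =
        root_sum (\<lambda>x. (512 / 563 + 1958 / 563 * x + (- 1220 / 563) * x ^ 2 + 1157 / 563 * x ^ 3) * x ^ n)"
    by (rule gen_tetranacci_binet) simp_all
  then show ?thesis
    unfolding root_sum_def by (simp only: cube insert_iff simp_thms mult.assoc distrib_left)
qed

lemma triple_sequence_binet:
  "gen_tetranacci (- 5) 2 13 32 n = root_sum (\<lambda>x. (6 * x - x ^ 3 - 1) * x ^ n)"
proof -
  have "gen_tetranacci (- 5) 2 13 32 n =
        root_sum (\<lambda>x. (- 1 + 6 * x + 0 * x ^ 2 + (- 1) * x ^ 3) * x ^ n)"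
    by (rule gen_tetranacci_binet) simp_all
  then show ?thesis
    by (simp add: algebra_simps)
qed

section \<open>Generating functions as symmetric polynomials in four exponentials\<close>

lemma egf_root_sum:
  "egf (\<lambda>n. root_sum (\<lambda>x. w x * r x ^ n)) = root_sum (\<lambda>x. fps_const (w x) * fps_exp (r x))"
  by (simp add: root_sum_def egf_add egf_cmult egf_power)

text \<open>
  One of the four summands of the exponential generating function of the Tetranacci numbers.
\<close>

definition binet_term :: "complex \<Rightarrow> complex fps" where
  "binet_term x = fps_const (coeff_T x) * fps_exp x"

lemma binet_term_power: "binet_term x ^ k = fps_const (coeff_T x ^ k) * fps_exp (of_nat k * x)"
  by (simp add: binet_term_def power_mult_distrib fps_exp_power_mult flip: fps_const_power)

lemma egf_tetranacci: "egf tetranacci = root_sum binet_term"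
  using egf_root_sum[of coeff_T "\<lambda>x. x"]
  by (simp add: tetranacci_binet[abs_def] binet_term_def[abs_def])

lemma egf_scaled_squares:
  "egf (\<lambda>n. 2 ^ n * gen_tetranacci 40 64 215 344 n) = 563 * root_sum (\<lambda>x. binet_term x ^ 2)"
proof -
  have "egf (\<lambda>n. 2 ^ n * gen_tetranacci 40 64 215 344 n) =
        egf (\<lambda>n. 563 * root_sum (\<lambda>x. coeff_T x ^ 2 * (2 * x) ^ n))"
    by (intro arg_cong[of _ _ egf] ext)
       (simp add: square_sequence_binet root_sum_def power_mult_distrib algebra_simps)
  then show ?thesis
    using egf_root_sum[of "\<lambda>x. coeff_T x ^ 2" "\<lambda>x. 2 * x"]
    by (simp add: egf_cmult binet_term_power numeral_fps_const)
qed

lemma egf_scaled_cubes: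
  "egf (\<lambda>n. 3 ^ n * gen_tetranacci 15 27 48 107 n) = 563 * root_sum (\<lambda>x. binet_term x ^ 3)"
proof -
  have "egf (\<lambda>n. 3 ^ n * gen_tetranacci 15 27 48 107 n) =
        egf (\<lambda>n. 563 * root_sum (\<lambda>x. coeff_T x ^ 3 * (3 * x) ^ n))"
    by (intro arg_cong[of _ _ egf] ext)
       (simp add: cube_sequence_binet root_sum_def power_mult_distrib algebra_simps)
  then show ?thesis
    using egf_root_sum[of "\<lambda>x. coeff_T x ^ 3" "\<lambda>x. 3 * x"]
    by (simp add: egf_cmult binet_term_power numeral_fps_const)
qed

text \<open>
  Summation with binomial coefficients multiplies the generating function by \<open>exp z\<close>, and the
  signs replace \<open>x\<close> by \<open>- x\<close>. The resulting exponent \<open>1 - x\<close> is the sum of the other three roots.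
\<close>

lemma egf_alternating_triples:
  "egf (\<lambda>n. \<Sum>k=0..n. of_nat (n choose k) * (- 1) ^ k * gen_tetranacci (- 5) 2 13 32 k) =
     - 563 * (binet_term b * binet_term c * binet_term d + binet_term a * binet_term c * binet_term d
              + binet_term a * binet_term b * binet_term d + binet_term a * binet_term b * binet_term c)"
proof -
  have sums: "1 + - a = b + c + d" "1 + - b = a + c + d" "1 + - c = a + b + d" "1 + - d = a + b + c"
    using e1 by algebra+
  have triple: "binet_term x * binet_term y * binet_term z =
      fps_const (coeff_T x * coeff_T y * coeff_T z) * fps_exp (x + y + z)" for x y z
    by (simp add: binet_term_def fps_exp_add_mult flip: fps_const_mult)
  have "egf (\<lambda>n. \<Sum>k=0..n. of_nat (n choose k) * (- 1) ^ k * gen_tetranacci (- 5) 2 13 32 k) =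
        egf (\<lambda>n. (- 1) ^ n * gen_tetranacci (- 5) 2 13 32 n) * egf (\<lambda>n. 1 ^ n)"
    by (simp add: egf_binomial_convolution[symmetric] mult.assoc)
  also have "egf (\<lambda>n. (- 1) ^ n * gen_tetranacci (- 5) 2 13 32 n) =
             egf (\<lambda>n. root_sum (\<lambda>x. (6 * x - x ^ 3 - 1) * (- x) ^ n))"
    by (intro arg_cong[of _ _ egf] ext)
       (simp add: triple_sequence_binet root_sum_def power_minus[of a] power_minus[of b]
          power_minus[of c] power_minus[of d] algebra_simps)
  also have "\<dots> = root_sum (\<lambda>x. fps_const (6 * x - x ^ 3 - 1) * fps_exp (- x))"
    by (rule egf_root_sum)
  also have "\<dots> * egf (\<lambda>n. 1 ^ n) =
      root_sum (\<lambda>x. fps_const (6 * x - x ^ 3 - 1) * fps_exp (1 + - x))"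
    unfolding egf_power fps_exp_add_mult root_sum_def
    by (simp only: distrib_left distrib_right mult_ac)
  also have "\<dots> = - 563 * (binet_term b * binet_term c * binet_term d + binet_term a * binet_term c * binet_term d
              + binet_term a * binet_term b * binet_term d + binet_term a * binet_term b * binet_term c)"
  proof -
    have const: "fps_const z = - 563 * fps_const (- z / 563)" for z :: complex
    proof -
      have "- 563 * fps_const (- z / 563) = fps_const (- 563) * fps_const (- z / 563)"
        by (simp add: numeral_fps_const)
      then show ?thesis by simp
    qed
    show ?thesis
      unfolding root_sum_def sums triple coeff_T_triple_products
      by (subst (1 2 3 4) const) (simp only: algebra_simps)
  qed
  finally show ?thesis .
qed

end

lemma ex_tetranacci_roots: "\<exists>a b c d. tetranacci_roots a b c d"
proof -
  let ?p = "[:- 1, - 1, - 1, - 1, 1:] :: complex poly"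
  have nonzero: "?p \<noteq> 0" and degree: "degree ?p = 4" and monic: "lead_coeff ?p = 1"
    by simp_all
  obtain R where "size R = degree ?p \<and> ?p = smult (lead_coeff ?p) (\<Prod>x\<in>#R. [:- x, 1:])"
    using alg_closed_imp_factorization[OF nonzero] by (rule exE)
  then have R: "size R = 4" "?p = (\<Prod>x\<in>#R. [:- x, 1:])"
    unfolding monic smult_1_left by (simp_all only: degree)
  from R(1) obtain a b c d where "R = {#a, b, c, d#}"
    by (auto simp: eval_nat_numeral elim!: size_mset_SucE)
  with R(2) have "?p = [:- a, 1:] * [:- b, 1:] * [:- c, 1:] * [:- d, 1:]"
    by (simp only: image_mset_add_mset prod_mset.add_mset image_mset_empty prod_mset_empty
        mult_1_right mult.assoc)
  also have "\<dots> = [:a * b * c * d, - (a * b * c + a * b * d + a * c * d + b * c * d),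
      a * b + a * c + a * d + b * c + b * d + c * d, - (a + b + c + d), 1:]"
    by (simp add: algebra_simps)
  finally have "[:a * b * c * d, - (a * b * c + a * b * d + a * c * d + b * c * d),
      a * b + a * c + a * d + b * c + b * d + c * d, - (a + b + c + d), 1:] = ?p"
    by (rule sym)
  then have "a * b * c * d = - 1" "- (a * b * c + a * b * d + a * c * d + b * c * d) = - 1"
    "a * b + a * c + a * d + b * c + b * d + c * d = - 1" "- (a + b + c + d) = - 1"
    unfolding pCons_eq_iff by blast+
  then have "tetranacci_roots a b c d"
    by unfold_locales (simp_all only: neg_equal_iff_equal)
  then show ?thesis by blast
qed

section \<open>The convolution formula\<close>

lemma egf_tetranacci_t:
  "egf tetranacci_t = fps_const (1 / 2) * (egf tetranacci * egf tetranacci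
     - fps_const (1 / 563) * egf (\<lambda>n. 2 ^ n * gen_tetranacci 40 64 215 344 n))"
  unfolding egf_binomial_convolution[symmetric] egf_cmult[symmetric] egf_diff[symmetric]
  by (simp add: tetranacci_t_def[abs_def])

text \<open>
  The part without \<open>\<delta>\<close> expresses the cube of a sum through power sums and \<open>e3\<close>; the factor of \<open>\<delta>\<close>
  is Newton's identity \<open>p3 = p1 p2 - p1 e2 + 3 e3\<close>, which is why the parameter is free.
\<close>

lemma cube_of_sum_of_four:
  fixes X Y Z W \<delta> :: "'a :: idom"
  defines "p1 \<equiv> X + Y + Z + W" and "e2 \<equiv> X * Y + X * Z + X * W + Y * Z + Y * W + Z * W"
    and "e3 \<equiv> Y * Z * W + X * Z * W + X * Y * W + X * Y * Z"
  shows "p1 ^ 3 = (\<delta> - 2) * (X ^ 3 + Y ^ 3 + Z ^ 3 + W ^ 3) + (6 - 3 * \<delta>) * e3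
           + (3 - \<delta>) * ((X ^ 2 + Y ^ 2 + Z ^ 2 + W ^ 2) * p1) + \<delta> * (p1 * e2)"
  unfolding p1_def e2_def e3_def by algebra

theorem theorem3:
  fixes A B C D :: complex and n :: nat
  assumes "A = D - 2" and "B = - 3 * D + 6" and "C = - D + 3"
  shows "(\<Sum>(k1, k2, k3) \<in> {(k1, k2, k3). k1 + k2 + k3 = n}.
            multinomial n [k1, k2, k3] * tetranacci k1 * tetranacci k2 * tetranacci k3) =
         A / 563 * 3 ^ n * gen_tetranacci 15 27 48 107 n
         - B / 563 * (\<Sum>k=0..n. of_nat (n choose k) * (- 1) ^ k * gen_tetranacci (- 5) 2 13 32 k)
         + C / 563 * (\<Sum>k=0..n. of_nat (n choose k) * 2 ^ (n - k)
                         * gen_tetranacci 40 64 215 344 (n - k) * tetranacci k)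
         + D * (\<Sum>k=0..n. of_nat (n choose k) * tetranacci k * tetranacci_t (n - k))"
proof -
  obtain a b c d where "tetranacci_roots a b c d"
    using ex_tetranacci_roots by blast
  then interpret tetranacci_roots a b c d .
  define X Y Z W where "X = binet_term a" and "Y = binet_term b" and "Z = binet_term c" and "W = binet_term d"
  note XYZW = X_def[symmetric] Y_def[symmetric] Z_def[symmetric] W_def[symmetric]
  let ?cubes = "\<lambda>n. 3 ^ n * gen_tetranacci 15 27 48 107 n"
  let ?triples = "\<lambda>n. \<Sum>k=0..n. of_nat (n choose k) * (- 1) ^ k * gen_tetranacci (- 5) 2 13 32 k"
  let ?squares = "\<lambda>n. 2 ^ n * gen_tetranacci 40 64 215 344 n"
  have T: "egf tetranacci = X + Y + Z + W"
    unfolding egf_tetranacci root_sum_def XYZW ..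
  have normalize: "fps_const (1 / 563) * (563 * F) = F" for F :: "complex fps"
    by (simp add: numeral_fps_const flip: mult.assoc)
  have cubes: "fps_const (1 / 563) * egf ?cubes = X ^ 3 + Y ^ 3 + Z ^ 3 + W ^ 3"
    unfolding egf_scaled_cubes normalize root_sum_def XYZW ..
  have squares: "fps_const (1 / 563) * egf ?squares = X ^ 2 + Y ^ 2 + Z ^ 2 + W ^ 2"
    unfolding egf_scaled_squares normalize root_sum_def XYZW ..
  have triples: "fps_const (1 / 563) * egf ?triples =
      - (Y * Z * W + X * Z * W + X * Y * W + X * Y * Z)"
    unfolding egf_alternating_triples mult_minus_left mult_minus_right normalize XYZW ..
  have t: "egf tetranacci_t = X * Y + X * Z + X * W + Y * Z + Y * W + Z * W"
  proof -
    have "egf tetranacci_t = fps_const (1 / 2) * (2 * (X * Y + X * Z + X * W + Y * Z + Y * W + Z * W))"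
      unfolding egf_tetranacci_t T squares by (rule arg_cong[of _ _ "(*) _"]) algebra
    then show ?thesis
      by (simp add: numeral_fps_const flip: mult.assoc)
  qed
  have coeffs: "fps_const A = fps_const D - 2" "fps_const B = 6 - 3 * fps_const D"
    "fps_const C = 3 - fps_const D"
    unfolding assms by (simp_all add: numeral_fps_const)
  have "egf tetranacci * egf tetranacci * egf tetranacci =
      fps_const A * (fps_const (1 / 563) * egf ?cubes)
      - fps_const B * (fps_const (1 / 563) * egf ?triples)
      + fps_const C * ((fps_const (1 / 563) * egf ?squares) * egf tetranacci)
      + fps_const D * (egf tetranacci * egf tetranacci_t)"
    using cube_of_sum_of_four[of X Y Z W "fps_const D"]
    unfolding cubes squares triples t T coeffs by (simp only: power3_eq_cube mult_minus_right diff_minus_eq_add)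
  also have "\<dots> =
      egf (\<lambda>n. A * (1 / 563 * ?cubes n) - B * (1 / 563 * ?triples n)
        + C * (\<Sum>k=0..n. of_nat (n choose k) * (1 / 563 * ?squares k) * tetranacci (n - k))
        + D * (\<Sum>k=0..n. of_nat (n choose k) * tetranacci k * tetranacci_t (n - k)))"
    unfolding egf_add egf_diff egf_cmult egf_binomial_convolution
      egf_binomial_convolution[of "\<lambda>n. 1 / 563 * ?squares n"] ..
  finally have "(\<Sum>(k1, k2, k3) \<in> {(k1, k2, k3). k1 + k2 + k3 = n}.
            multinomial n [k1, k2, k3] * tetranacci k1 * tetranacci k2 * tetranacci k3) =
      A * (1 / 563 * ?cubes n) - B * (1 / 563 * ?triples n)
        + C * (\<Sum>k=0..n. of_nat (n choose k) * (1 / 563 * ?squares k) * tetranacci (n - k))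
        + D * (\<Sum>k=0..n. of_nat (n choose k) * tetranacci k * tetranacci_t (n - k))"
    unfolding egf_multinomial_convolution[symmetric] egf_inject by (rule fun_cong)
  also have "(\<Sum>k=0..n. of_nat (n choose k) * (1 / 563 * ?squares k) * tetranacci (n - k)) =
      1 / 563 * (\<Sum>k=0..n. of_nat (n choose k) * 2 ^ (n - k)
                         * gen_tetranacci 40 64 215 344 (n - k) * tetranacci k)"
    unfolding sum_distrib_left
    by (rule sum.reindex_bij_witness[where i = "\<lambda>k. n - k" and j = "\<lambda>k. n - k"])
       (auto simp: binomial_symmetric[symmetric] mult_ac)
  finally show ?thesis
    by (simp add: mult_ac)
qed

end
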